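(* Every $d$-degenerate triangle-free graph $G$ satisfies $$\chi_f^{\mathrm{DP}}(G) \le (4+o(1))\frac{d}{\log d},$$ where $o(1)$ denotes a quantity depending only on $d$ that tends to $0$ as $d\to\infty$.
   Context: All graphs are finite, simple and undirected; $\log$ is the natural logarithm. A graph is $d$-degenerate if it admits a vertex ordering in which each vertex has at most $d$ neighbors preceding it. A DP-cover (correspondence cover) of $G$ is a pair $\mathcal{H}=(L,H)$ where $H$ is a graph and $L:V(G)\to 2^{V(H)}$ satisfies: (DP1) $\{L(v):v\in V(G)\}$ is a partition of $V(H)$; (DP2) each $L(v)$ is an independent set in $H$; (DP3) for all distinct $u,v\in V(G)$, the edge set of $H[L(u)\cup L(v)]$ is a matching, empty if $uv\notin E(G)$. It is $q$-fold if $|L(v)|=q$ for all $v$. For $\eta\in[0,1]$, an $(\eta,\mathcal{H})$-coloring of $G$ is an independent set $S\subseteq V(H)$ with $|S\cap L(u)|\ge\eta|L(u)|$ for all $u\in V(G)$. For $q\in\mathbb{N}^+$ let $\theta_{\mathrm{DP}}(G,q)$ be the maximum $\eta\in[0,1]$ such that $G$ admits an $(\eta,\mathcal{H})$-coloring for every $q$-fold DP-cover $\mathcal{H}$ of $G$. The fractional DP-chromatic number is $\chi_f^{\mathrm{DP}}(G)=\inf\{\theta_{\mathrm{DP}}(G,q)^{-1}: q\in\mathbb{N}^+\}$. *)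

theory Defs
  imports Complex_Main "HOL-Library.Disjoint_Sets" "HOL-Library.Extended_Real"
begin

definition fin_simple_graph :: "'a set \<Rightarrow> 'a set set \<Rightarrow> bool" where
  "fin_simple_graph V E \<longleftrightarrow>
     finite V \<and> (\<forall>e\<in>E. \<exists>u\<in>V. \<exists>v\<in>V. u \<noteq> v \<and> e = {u, v})"

definition triangle_free :: "'a set set \<Rightarrow> bool" where
  "triangle_free E \<longleftrightarrow> \<not> (\<exists>u v w. {u, v} \<in> E \<and> {v, w} \<in> E \<and> {u, w} \<in> E)"

definition degenerate :: "nat \<Rightarrow> 'a set \<Rightarrow> 'a set set \<Rightarrow> bool" where
  "degenerate d V E \<longleftrightarrow>
     (\<exists>xs. distinct xs \<and> set xs = V \<and>
       (\<forall>i < length xs. card {j. j < i \<and> {xs ! j, xs ! i} \<in> E} \<le> d))"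

definition induced_edges :: "'a set set \<Rightarrow> 'a set \<Rightarrow> 'a set set" where
  "induced_edges E A = {e \<in> E. e \<subseteq> A}"

definition independent_set :: "'a set \<Rightarrow> 'a set set \<Rightarrow> 'a set \<Rightarrow> bool" where
  "independent_set V E S \<longleftrightarrow> S \<subseteq> V \<and> induced_edges E S = {}"

definition matching :: "'a set set \<Rightarrow> bool" where
  "matching M \<longleftrightarrow> disjoint M"

(* The partition is indexed by the vertices of G, so distinct vertices must
   have distinct (hence disjoint) lists: this is the role of inj_on. *)
definition DP_cover ::
  "'a set \<Rightarrow> 'a set set \<Rightarrow> ('a \<Rightarrow> 'b set) \<Rightarrow> 'b set \<Rightarrow> 'b set set \<Rightarrow> bool" where
  "DP_cover V E L VH EH \<longleftrightarrow>
     fin_simple_graph VH EH \<and>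
     partition_on VH (L ` V) \<and> inj_on L V \<and>
     (\<forall>v\<in>V. independent_set VH EH (L v)) \<and>
     (\<forall>u\<in>V. \<forall>v\<in>V. u \<noteq> v \<longrightarrow>
        matching (induced_edges EH (L u \<union> L v)) \<and>
        ({u, v} \<notin> E \<longrightarrow> induced_edges EH (L u \<union> L v) = {}))"

definition q_fold :: "nat \<Rightarrow> 'a set \<Rightarrow> ('a \<Rightarrow> 'b set) \<Rightarrow> bool" where
  "q_fold q V L \<longleftrightarrow> (\<forall>v\<in>V. card (L v) = q)"

definition DP_coloring ::
  "real \<Rightarrow> 'a set \<Rightarrow> ('a \<Rightarrow> 'b set) \<Rightarrow> 'b set \<Rightarrow> 'b set set \<Rightarrow> 'b set \<Rightarrow> bool" where
  "DP_coloring \<eta> V L VH EH S \<longleftrightarrow>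
     independent_set VH EH S \<and>
     (\<forall>u\<in>V. real (card (S \<inter> L u)) \<ge> \<eta> * real (card (L u)))"

(* Cover graphs are finite, so up to isomorphism their vertices are natural
   numbers; theta_DP_attained below shows that covers over any other vertex type
   impose no further constraint, and that the supremum is a maximum. *)
definition admissible_fractions :: "'a set \<Rightarrow> 'a set set \<Rightarrow> nat \<Rightarrow> real set" where
  "admissible_fractions V E q =
     {\<eta>. 0 \<le> \<eta> \<and> \<eta> \<le> 1 \<and>
        (\<forall>(L :: 'a \<Rightarrow> nat set) VH EH. DP_cover V E L VH EH \<and> q_fold q V L \<longrightarrow>
           (\<exists>S. DP_coloring \<eta> V L VH EH S))}"

definition theta_DP :: "'a set \<Rightarrow> 'a set set \<Rightarrow> nat \<Rightarrow> real" where
  "theta_DP V E q = Sup (admissible_fractions V E q)"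

(* theta_DP may be 0 (a single edge with q = 1), in which case its inverse has to
   be infinite; inverse on ereal does this, whereas inverse (0::real) = 0. *)
definition chi_f_DP :: "'a set \<Rightarrow> 'a set set \<Rightarrow> ereal" where
  "chi_f_DP V E = (INF q\<in>{1..}. inverse (ereal (theta_DP V E q)))"


lemma zero_admissible: "0 \<in> admissible_fractions V E q"
proof -
  have "DP_coloring 0 V L VH EH {}" if "DP_cover V E L VH EH"
    for L :: "'a \<Rightarrow> nat set" and VH EH
  proof -
    have "\<forall>e\<in>EH. \<not> e \<subseteq> {}"
      using that unfolding DP_cover_def fin_simple_graph_def by fastforce
    then show ?thesis
      unfolding DP_coloring_def independent_set_def induced_edges_def by auto
  qed
  then show ?thesis
    unfolding admissible_fractions_def by auto
qed

lemma bdd_above_admissible: "bdd_above (admissible_fractions V E q)"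
  unfolding admissible_fractions_def by (rule bdd_aboveI[of _ 1]) auto

lemma theta_DP_bounds: "0 \<le> theta_DP V E q" "theta_DP V E q \<le> 1"
  unfolding theta_DP_def
proof -
  show "0 \<le> Sup (admissible_fractions V E q)"
    using cSup_upper[OF zero_admissible bdd_above_admissible] by blast
  have "admissible_fractions V E q \<noteq> {}"
    using zero_admissible by blast
  then show "Sup (admissible_fractions V E q) \<le> 1"
    by (rule cSup_least) (simp add: admissible_fractions_def)
qed

lemma theta_DP_admissible: "theta_DP V E q \<in> admissible_fractions V E q"
proof -
  have "\<exists>S. DP_coloring (theta_DP V E q) V L VH EH S"
    if c: "DP_cover V E L VH EH" "q_fold q V L" for L :: "'a \<Rightarrow> nat set" and VH EH
  proof (cases "theta_DP V E q * q > 0")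
    case False
    then have "theta_DP V E q * q = 0"
      using theta_DP_bounds(1)[of V E q] mult_nonneg_nonneg[of "theta_DP V E q" "real q"] by linarith
    moreover obtain S where "DP_coloring 0 V L VH EH S"
      using zero_admissible[of V E q] c unfolding admissible_fractions_def by blast
    ultimately have "DP_coloring (theta_DP V E q) V L VH EH S"
      using c(2) unfolding DP_coloring_def q_fold_def by auto
    then show ?thesis ..
  next
    case True
    define t where "t = theta_DP V E q"
    define k where "k = \<lceil>t * q\<rceil>"
    have q: "real q > 0" using True by (cases q) auto
    have "real_of_int k - 1 < t * q" unfolding k_def by linarith
    then have "(real_of_int k - 1) / q < t" using q by (simp add: pos_divide_less_eq)
    then obtain \<eta> where \<eta>: "\<eta> \<in> admissible_fractions V E q" "(real_of_int k - 1) / q < \<eta>"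
      unfolding t_def theta_DP_def using zero_admissible by (metis less_cSupE empty_iff)
    obtain S where S: "DP_coloring \<eta> V L VH EH S"
      using \<eta>(1) c unfolding admissible_fractions_def by blast
    have "t * real (card (L u)) \<le> real (card (S \<inter> L u))" if "u \<in> V" for u
    proof -
      have "\<eta> * q \<le> real (card (S \<inter> L u))" "card (L u) = q"
        using S c(2) that unfolding DP_coloring_def q_fold_def by auto
      moreover have "real_of_int k - 1 < \<eta> * q" using \<eta>(2) q by (simp add: pos_divide_less_eq)
      ultimately have "k \<le> int (card (S \<inter> L u))" by linarith
      then show ?thesis using \<open>card (L u) = q\<close> unfolding k_def by (simp add: ceiling_le_iff)
    qed
    then have "DP_coloring t V L VH EH S"
      using S unfolding DP_coloring_def by auto
    then show ?thesis unfolding t_def by blast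
  qed
  then show ?thesis
    using theta_DP_bounds unfolding admissible_fractions_def by blast
qed

lemma DP_cover_image:
  fixes f :: "'b \<Rightarrow> 'c"
  assumes c: "DP_cover V E L VH EH" and f: "inj_on f VH"
  shows "DP_cover V E (\<lambda>v. f ` L v) (f ` VH) ((`) f ` EH)"
proof -
  have sub: "L v \<subseteq> VH" if "v \<in> V" for v
    using c that unfolding DP_cover_def independent_set_def by auto
  have esub: "e \<subseteq> VH" if "e \<in> EH" for e
    using c that unfolding DP_cover_def fin_simple_graph_def by fastforce
  have ind: "induced_edges ((`) f ` EH) (f ` A) = (`) f ` induced_edges EH A"
    if A: "A \<subseteq> VH" for A
  proof -
    have "f ` e \<subseteq> f ` A \<longleftrightarrow> e \<subseteq> A" if "e \<in> EH" for e
      using inj_on_image_mem_iff[OF f _ A] esub[OF that] by blast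
    then show ?thesis unfolding induced_edges_def by blast
  qed
  have cg: "fin_simple_graph VH EH" using c by (simp add: DP_cover_def)
  have disj: "disjoint ((`) f ` M)" if "disjoint M" "\<And>x. x \<in> M \<Longrightarrow> x \<subseteq> VH" for M
  proof (rule disjointI)
    fix a b assume "a \<in> (`) f ` M" "b \<in> (`) f ` M" "a \<noteq> b"
    then obtain x y where xy: "x \<in> M" "y \<in> M" "a = f ` x" "b = f ` y" "x \<noteq> y" by auto
    then have "x \<inter> y = {}" using that(1) by (auto dest: disjointD)
    then show "a \<inter> b = {}"
      using inj_on_image_Int[OF f that(2)[OF xy(1)] that(2)[OF xy(2)]] xy by simp
  qed
  have "fin_simple_graph (f ` VH) ((`) f ` EH)"
    unfolding fin_simple_graph_def
  proof (intro conjI ballI)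
    show "finite (f ` VH)" using cg by (simp add: fin_simple_graph_def)
    fix e assume "e \<in> (`) f ` EH"
    then obtain e' where e': "e' \<in> EH" "e = f ` e'" by auto
    then obtain u v where uv: "u \<in> VH" "v \<in> VH" "u \<noteq> v" "e' = {u, v}"
      using cg unfolding fin_simple_graph_def by meson
    then have "f u \<noteq> f v \<and> e = {f u, f v}"
      using f e' by (simp add: inj_on_eq_iff)
    then show "\<exists>u\<in>f ` VH. \<exists>v\<in>f ` VH. u \<noteq> v \<and> e = {u, v}"
      using uv by (intro bexI[of _ "f u"] bexI[of _ "f v"] imageI)
  qed
  moreover have p: "partition_on VH (L ` V)" using c by (simp add: DP_cover_def)
  have "partition_on (f ` VH) ((\<lambda>v. f ` L v) ` V)"
  proof -
    have eq: "(\<lambda>v. f ` L v) ` V = (`) f ` (L ` V)" by (simp add: image_image)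
    have "disjoint ((`) f ` (L ` V))"
      using p sub by (intro disj) (auto simp: partition_on_def)
    moreover have "\<Union> ((`) f ` (L ` V)) = f ` VH"
      using p unfolding partition_on_def by blast
    moreover have "{} \<notin> (`) f ` (L ` V)"
      using p unfolding partition_on_def by auto
    ultimately show ?thesis unfolding eq partition_on_def by simp
  qed
  moreover have "inj_on (\<lambda>v. f ` L v) V"
  proof (rule inj_onI)
    fix u v assume "u \<in> V" "v \<in> V" "f ` L u = f ` L v"
    then have "L u = L v" using inj_on_image_eq_iff[OF f sub sub] by blast
    then show "u = v" using c \<open>u \<in> V\<close> \<open>v \<in> V\<close> unfolding DP_cover_def by (auto dest: inj_onD)
  qed
  moreover have "independent_set (f ` VH) ((`) f ` EH) (f ` L v)" if "v \<in> V" for v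
    using c that ind[OF sub[OF that]] unfolding DP_cover_def independent_set_def by auto
  moreover have "matching (induced_edges ((`) f ` EH) (f ` L u \<union> f ` L v)) \<and>
      ({u, v} \<notin> E \<longrightarrow> induced_edges ((`) f ` EH) (f ` L u \<union> f ` L v) = {})"
    if "u \<in> V" "v \<in> V" "u \<noteq> v" for u v
  proof -
    have m: "disjoint (induced_edges EH (L u \<union> L v))"
         "{u, v} \<notin> E \<longrightarrow> induced_edges EH (L u \<union> L v) = {}"
      using c that unfolding DP_cover_def matching_def by auto
    have "disjoint ((`) f ` induced_edges EH (L u \<union> L v))"
      using m(1) esub by (intro disj) (auto simp: induced_edges_def)
    moreover have "induced_edges ((`) f ` EH) (f ` L u \<union> f ` L v)
        = (`) f ` induced_edges EH (L u \<union> L v)"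
      using ind[of "L u \<union> L v"] sub[OF \<open>u \<in> V\<close>] sub[OF \<open>v \<in> V\<close>]
      by (simp add: image_Un)
    ultimately show ?thesis
      using m(2) unfolding matching_def by simp
  qed
  ultimately show ?thesis unfolding DP_cover_def by (intro conjI ballI impI) simp_all
qed

lemma theta_DP_attained:
  fixes L :: "'a \<Rightarrow> 'b set"
  assumes c: "DP_cover V E L VH EH" and q: "q_fold q V L"
  shows "\<exists>S. DP_coloring (theta_DP V E q) V L VH EH S"
proof -
  have fin: "finite VH" and sub: "\<And>v. v \<in> V \<Longrightarrow> L v \<subseteq> VH"
    using c unfolding DP_cover_def fin_simple_graph_def independent_set_def by auto
  obtain g :: "'b \<Rightarrow> nat" where g: "inj_on g VH"
    using finite_imp_inj_to_nat_seg[OF fin] by blast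
  have cardg: "card (g ` A) = card A" if "A \<subseteq> VH" for A
    using g that by (meson card_image inj_on_subset)
  have "q_fold q V (\<lambda>v. g ` L v)" using q sub cardg unfolding q_fold_def by simp
  then obtain S where
    S: "DP_coloring (theta_DP V E q) V (\<lambda>v. g ` L v) (g ` VH) ((`) g ` EH) S"
    using theta_DP_admissible[of V E q] DP_cover_image[OF c g]
    unfolding admissible_fractions_def by blast
  define T where "T = VH \<inter> g -` S"
  have T: "T \<subseteq> VH" "g ` T = S"
    using S unfolding T_def DP_coloring_def independent_set_def by auto
  have "induced_edges EH T = {}"
  proof -
    have "g ` e \<in> induced_edges ((`) g ` EH) S" if "e \<in> induced_edges EH T" for e
      using that T(2) unfolding induced_edges_def by auto
    then show ?thesis using S unfolding DP_coloring_def independent_set_def by blast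
  qed
  moreover have "theta_DP V E q * real (card (L u)) \<le> real (card (T \<inter> L u))" if "u \<in> V" for u
  proof -
    have "S \<inter> g ` L u = g ` (T \<inter> L u)"
      using inj_on_image_Int[OF g T(1) sub[OF that]] T(2) by simp
    then show ?thesis
      using S that cardg[OF sub[OF that]] cardg[of "T \<inter> L u"] T(1)
      unfolding DP_coloring_def by (metis inf.coboundedI1)
  qed
  ultimately have "DP_coloring (theta_DP V E q) V L VH EH T"
    using T(1) unfolding DP_coloring_def independent_set_def by blast
  then show ?thesis ..
qed

end

(* Process the vertices of the cover graph in a degeneracy order. A vertex x carries a weight that
   starts at p, becomes 0 once an earlier neighbour of x is chosen, and is divided by 1 - (the
   probability of choosing y) whenever an earlier neighbour y is passed over; x is chosen with
   probability equal to its weight, or 0 if the weight exceeds a cap c. The weight is a martingale,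
   so it has mean p; in a triangle-free graph the product of the weights of adjacent vertices is a
   martingale too, so it has mean p^2. A weight above c forces the weights of the earlier
   neighbours to add up to at least M = (1 - c) ln (c / p); by Markov's inequality (under the measure
   tilted by the weight) the truncation loses at most a fraction d p / M of p. With
   p = ln d / (2 d), c = 1 / ln d every vertex is chosen with probability (1/4 - o(1)) ln d / d.
   The choices at two vertices without a common ancestor are independent, and in a q-fold cover of
   a fixed graph all but O(q) pairs in a list are of this kind, so for large q the second moment
   method makes all lists simultaneously attain nearly their expected share. *)

theory Submission
  imports Defs "HOL-Real_Asymp.Real_Asymp"
begin

section \<open>The sequential random choice on an abstract relation of earlier neighbours\<close>

locale sequential_choice =
  fixes N :: "'b \<Rightarrow> 'b set" and rank :: "'b \<Rightarrow> nat" and p c :: real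
  assumes rank_less: "y \<in> N x \<Longrightarrow> rank y < rank x"
    and finite_N: "finite (N x)"
    and p_pos: "0 < p" and c_nonneg: "0 \<le> c" and c_less_1: "c < 1"
begin

definition dclosed :: "'b set \<Rightarrow> bool" where
  "dclosed A \<longleftrightarrow> (\<forall>x\<in>A. N x \<subseteq> A)"

text \<open>The conditional probability of choosing x when T records the earlier choices. Being
  total in T, it gives the joint law as an explicit finite product, with no probability space. The
  cap c < 1 keeps every denominator positive.\<close>

function sel :: "'b set \<Rightarrow> 'b \<Rightarrow> real" where
  "sel T x =
     (let w = (if N x \<inter> T = {} then p * (\<Prod>y\<in>N x. 1 / (1 - sel T y)) else 0)
      in if w \<le> c then w else 0)"
  by auto
termination
  by (relation "measure (\<lambda>(T, x). rank x)") (auto simp: rank_less)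

declare sel.simps [simp del]

text \<open>The weight of x after the vertices in A have been processed, T being the set chosen so far.\<close>

definition weight :: "'b set \<Rightarrow> 'b set \<Rightarrow> 'b \<Rightarrow> real" where
  "weight A T x =
     (if N x \<inter> A \<inter> T = {} then p * (\<Prod>y\<in>N x \<inter> A. 1 / (1 - sel T y)) else 0)"

lemma sel_eq_weight:
  assumes "N x \<subseteq> A"
  shows "sel T x = (if weight A T x \<le> c then weight A T x else 0)"
proof -
  have "N x \<inter> A = N x" using assms by blast
  then show ?thesis unfolding sel.simps[of T x] weight_def Let_def by simp
qed

lemma sel_le_c: "sel T x \<le> c"
  using sel_eq_weight[of x UNIV T] c_nonneg by auto

lemma sel_less_1: "sel T x < 1"
  using sel_le_c[of T x] c_less_1 by linarith

lemma weight_nonneg: "0 \<le> weight A T x"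
  using sel_less_1 p_pos unfolding weight_def
  by (auto intro!: mult_nonneg_nonneg prod_nonneg simp: less_imp_le)

lemma sel_nonneg: "0 \<le> sel T x"
  using sel_eq_weight[of x UNIV T] weight_nonneg[of UNIV T x] by auto

lemma sel_le_weight:
  assumes "N x \<subseteq> A" shows "sel T x \<le> weight A T x"
  using sel_eq_weight[OF assms, of T] weight_nonneg[of A T x] by auto

text \<open>The recursion started at x only visits \<open>N x\<close> and what lies below it, all
  inside A. The vertex x itself may lie outside A, which covers the next vertex to be
  processed.\<close>

lemma sel_local:
  assumes "dclosed A" "N x \<subseteq> A" "T \<inter> A = T' \<inter> A"
  shows "sel T x = sel T' x"
  using assms(2)
proof (induction "rank x" arbitrary: x rule: less_induct)
  case less
  have "sel T y = sel T' y" if "y \<in> N x" for y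
    using less rank_less[OF that] that assms(1) unfolding dclosed_def by blast
  moreover have "N x \<inter> T = N x \<inter> T'" using less(2) assms(3) by blast
  ultimately show ?case unfolding sel.simps[of T x] sel.simps[of T' x] by simp
qed

text \<open>Induction along the process: A grows out of B one vertex at a time through closed sets.
  Read backwards, a vertex of maximal rank in \<open>A' - B\<close> can always be removed.\<close>

lemma dclosed_induct [consumes 4, case_names base insert]:
  assumes "finite A" "dclosed A" "dclosed B" "B \<subseteq> A" "P B"
    and step: "\<And>A' m. \<lbrakk>B \<subseteq> A'; insert m A' \<subseteq> A; dclosed A'; finite A'; N m \<subseteq> A'; m \<notin> A'; P A'\<rbrakk>
      \<Longrightarrow> P (insert m A')"
  shows "P A"
proof -
  have "P A'" if "A' \<subseteq> A" "dclosed A'" "B \<subseteq> A'" for A'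
    using that
  proof (induction "card (A' - B)" arbitrary: A')
    case 0
    then have "A' = B" using finite_subset[OF 0(2) assms(1)] 0 by auto
    then show ?case using assms(5) by simp
  next
    case (Suc k)
    have fin: "finite (A' - B)" using finite_subset[OF Suc(3) assms(1)] by simp
    have ne: "A' - B \<noteq> {}" using Suc(2) by (metis card.empty nat.distinct(1))
    obtain m where m: "m \<in> A' - B" "\<And>y. y \<in> A' - B \<Longrightarrow> rank y \<le> rank m"
      using obtains_MAX[OF fin ne, of rank] Max_ge[of "rank ` (A' - B)"] fin by (metis finite_imageI imageI)
    define A0 where "A0 = A' - {m}"
    \<comment> \<open>For y outside B this is maximality of the rank of m; for y in B it holds
      because B is closed and m is not in B.\<close>
    have notN: "m \<notin> N y" if "y \<in> A'" for y
      using that m assms(3) rank_less[of m y] unfolding dclosed_def by fastforce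
    have A0: "dclosed A0" using Suc(4) notN unfolding dclosed_def A0_def by blast
    have "card (A0 - B) = k" using Suc(2) m(1) fin unfolding A0_def
      by (metis Diff_insert Diff_insert2 card_Diff_singleton diff_Suc_1)
    then have "P A0" using Suc(1)[of A0] A0 Suc(3,5) m(1) unfolding A0_def by blast
    moreover have "N m \<subseteq> A0" using Suc(4) m(1) notN[of m] unfolding dclosed_def A0_def by blast
    moreover have "insert m A0 = A'" using m(1) unfolding A0_def by auto
    ultimately show ?case
      using step[of A0 m] A0 Suc(3,5) m(1) finite_subset[OF Suc(3) assms(1)] unfolding A0_def by auto
  qed
  then show ?thesis using assms by blast
qed

text \<open>The probability that, of a set A closed under earlier neighbours, exactly T is chosen.\<close>

definition prob :: "'b set \<Rightarrow> 'b set \<Rightarrow> real" where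
  "prob A T = (\<Prod>x\<in>A. if x \<in> T then sel T x else 1 - sel T x)"

definition expect :: "'b set \<Rightarrow> ('b set \<Rightarrow> real) \<Rightarrow> real" where
  "expect A F = (\<Sum>T\<in>Pow A. prob A T * F T)"

lemma prob_nonneg: "0 \<le> prob A T"
  unfolding prob_def using sel_nonneg sel_less_1 by (intro prod_nonneg) (auto simp: less_imp_le)

lemma expect_cong:
  assumes "\<And>T. T \<subseteq> A \<Longrightarrow> F T = G T" shows "expect A F = expect A G"
  unfolding expect_def using assms by (intro sum.cong) auto

lemma expect_mono:
  assumes "\<And>T. T \<subseteq> A \<Longrightarrow> prob A T \<noteq> 0 \<Longrightarrow> F T \<le> G T" shows "expect A F \<le> expect A G"
  unfolding expect_def
proof (intro sum_mono)
  fix T assume "T \<in> Pow A"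
  then show "prob A T * F T \<le> prob A T * G T"
    using assms[of T] prob_nonneg[of A T] by (cases "prob A T = 0") (auto intro: mult_left_mono)
qed

lemma expect_add: "expect A (\<lambda>T. F T + G T) = expect A F + expect A G"
  unfolding expect_def by (simp add: sum.distrib distrib_left)

lemma expect_diff: "expect A (\<lambda>T. F T - G T) = expect A F - expect A G"
  unfolding expect_def by (simp add: sum_subtractf right_diff_distrib)

lemma expect_cmult: "expect A (\<lambda>T. a * F T) = a * expect A F"
  unfolding expect_def by (simp add: sum_distrib_left algebra_simps)

lemma expect_sum: "expect A (\<lambda>T. \<Sum>i\<in>I. F i T) = (\<Sum>i\<in>I. expect A (F i))"
  unfolding expect_def sum_distrib_left by (rule sum.swap)

lemma expect_empty: "expect {} F = F {}"
  unfolding expect_def prob_def by simp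

text \<open>Conditioning on all choices except the last. By \<open>sel_local\<close>, the outcome at
  m changes no selection probability in A, so the factor of m splits off the product.\<close>

lemma expect_insert:
  assumes A: "finite A" "dclosed A" and m: "N m \<subseteq> A" "m \<notin> A"
  shows "expect (insert m A) F = expect A (\<lambda>T. sel T m * F (insert m T) + (1 - sel T m) * F T)"
proof -
  have loc: "sel (insert m T) x = sel T x" if "x \<in> insert m A" for T x
    using that A(2) m by (intro sel_local[of A]) (auto simp: dclosed_def)
  have p1: "prob (insert m A) (insert m T) = sel T m * prob A T" if "T \<subseteq> A" for T
  proof -
    have "(\<Prod>x\<in>A. if x \<in> insert m T then sel (insert m T) x else 1 - sel (insert m T) x) = prob A T"
      unfolding prob_def using m loc by (intro prod.cong) auto
    then show ?thesis unfolding prob_def[of "insert m A"] using A m loc[of m T] by simp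
  qed
  have p2: "prob (insert m A) T = (1 - sel T m) * prob A T" if "T \<subseteq> A" for T
    unfolding prob_def using that A m by auto
  have inj: "inj_on (insert m) (Pow A)"
    using m(2) by (auto simp: inj_on_def insert_ident)
  have "expect (insert m A) F = (\<Sum>T\<in>Pow A. prob (insert m A) T * F T)
      + (\<Sum>T\<in>insert m ` Pow A. prob (insert m A) T * F T)"
    unfolding expect_def Pow_insert using A m by (intro sum.union_disjoint) auto
  also have "(\<Sum>T\<in>insert m ` Pow A. prob (insert m A) T * F T)
      = (\<Sum>T\<in>Pow A. prob (insert m A) (insert m T) * F (insert m T))"
    using sum.reindex[OF inj] by simp
  also have "(\<Sum>T\<in>Pow A. prob (insert m A) T * F T)
      + (\<Sum>T\<in>Pow A. prob (insert m A) (insert m T) * F (insert m T))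
      = expect A (\<lambda>T. sel T m * F (insert m T) + (1 - sel T m) * F T)"
    unfolding expect_def sum.distrib[symmetric]
    by (intro sum.cong) (auto simp: p1 p2 algebra_simps)
  finally show ?thesis .
qed

section \<open>Marginals and independence\<close>

definition determined :: "('b set \<Rightarrow> real) \<Rightarrow> 'b set \<Rightarrow> bool" where
  "determined F B \<longleftrightarrow> (\<forall>T T'. T \<inter> B = T' \<inter> B \<longrightarrow> F T = F T')"

lemma determinedD: "determined F B \<Longrightarrow> T \<inter> B = T' \<inter> B \<Longrightarrow> F T = F T'"
  unfolding determined_def by blast

lemma expect_marginal:
  assumes "finite A" "dclosed A" "dclosed B" "B \<subseteq> A" and F: "determined F B"
  shows "expect A F = expect B F"
  using assms(1-4)
proof (induction rule: dclosed_induct)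
  case base show ?case ..
next
  case (insert A' m)
  have "F (insert m T) = F T" for T
    using insert by (intro determinedD[OF F]) auto
  then have "expect (insert m A') F = expect A' F"
    using insert by (simp add: expect_insert algebra_simps)
  then show ?case using insert by simp
qed

lemma expect_const:
  assumes "finite A" "dclosed A"
  shows "expect A (\<lambda>_. a) = a"
  using expect_marginal[of A "{}" "\<lambda>_. a"] assms
  by (simp add: expect_empty determined_def dclosed_def)

text \<open>Both sets are closed and they are disjoint, so neither process ever consults the other.
  The induction removes the last vertex of B by averaging it out of G, hence G has to be universally
  quantified in the induction.\<close>

lemma expect_indep:
  assumes A: "finite A" "dclosed A" and B: "finite B" "dclosed B" and disj: "A \<inter> B = {}"
    and F: "determined F A" and G: "determined G B"
  shows "expect (A \<union> B) (\<lambda>T. F T * G T) = expect A F * expect B G"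
proof -
  have "dclosed {}" by (simp add: dclosed_def)
  have "\<forall>G. determined G B \<longrightarrow> expect (A \<union> B) (\<lambda>T. F T * G T) = expect A F * expect B G"
    using B \<open>dclosed {}\<close> empty_subsetI disj
  proof (induction rule: dclosed_induct)
    case base
    show ?case
    proof (intro allI impI)
      fix G :: "'b set \<Rightarrow> real" assume "determined G {}"
      then have "G T = G {}" for T by (auto simp: determined_def)
      then have "expect A (\<lambda>T. F T * G T) = expect A (\<lambda>T. G {} * F T)"
        by (metis mult.commute)
      then show "expect (A \<union> {}) (\<lambda>T. F T * G T) = expect A F * expect {} G"
        by (simp add: expect_cmult expect_empty)
    qed
  next
    case (insert B' m)
    have IH: "expect (A \<union> B') (\<lambda>T. F T * G T) = expect A F * expect B' G" if "determined G B'" for G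
      using insert that by auto
    have cl: "dclosed (A \<union> B')" using A insert by (auto simp: dclosed_def)
    show ?case
    proof (intro allI impI)
      fix G assume G: "determined G (insert m B')"
      \<comment> \<open>averaging G over the choice at m gives a function determined by B'\<close>
      define G' where "G' = (\<lambda>T. sel T m * G (insert m T) + (1 - sel T m) * G (T - {m}))"
      have G': "determined G' B'" unfolding determined_def
      proof (intro allI impI)
        fix T T' assume eq: "T \<inter> B' = T' \<inter> B'"
        have "sel T m = sel T' m" using insert eq by (intro sel_local[of B']) auto
        moreover have "G (insert m T) = G (insert m T')" "G (T - {m}) = G (T' - {m})"
          using eq by (auto intro!: determinedD[OF G])
        ultimately show "G' T = G' T'" unfolding G'_def by simp
      qed
      have Fm: "F (insert m T) = F T" for T
        using insert by (intro determinedD[OF F]) auto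
      have "m \<notin> A" using insert by auto
      have "expect (A \<union> insert m B') (\<lambda>T. F T * G T)
          = expect (A \<union> B') (\<lambda>T. sel T m * (F (insert m T) * G (insert m T)) + (1 - sel T m) * (F T * G T))"
        using expect_insert[of "A \<union> B'" m "\<lambda>T. F T * G T"] cl A insert \<open>m \<notin> A\<close> by auto
      also have "\<dots> = expect (A \<union> B') (\<lambda>T. F T * G' T)"
      proof (rule expect_cong)
        fix T assume "T \<subseteq> A \<union> B'"
        then have "T - {m} = T" using \<open>m \<notin> A\<close> insert by auto
        then show "sel T m * (F (insert m T) * G (insert m T)) + (1 - sel T m) * (F T * G T) = F T * G' T"
          unfolding G'_def Fm by (simp add: algebra_simps)
      qed
      also have "\<dots> = expect A F * expect B' G'" by (rule IH[OF G'])
      also have "expect B' G' = expect (insert m B') G"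
        unfolding expect_insert[OF insert(4,3,5,6)]
      proof (rule expect_cong)
        fix T assume "T \<subseteq> B'"
        then have "T - {m} = T" using insert by auto
        then show "G' T = sel T m * G (insert m T) + (1 - sel T m) * G T" unfolding G'_def by simp
      qed
      finally show "expect (A \<union> insert m B') (\<lambda>T. F T * G T) = expect A F * expect (insert m B') G" .
    qed
  qed
  then show ?thesis using G by blast
qed

section \<open>The weights as martingales, and the loss through truncation\<close>

lemma weight_insert:
  assumes "dclosed A" "N m \<subseteq> A" "m \<notin> A" "T \<subseteq> A"
  shows "weight (insert m A) (insert m T) x = (if m \<in> N x then 0 else weight A T x)"
    and "weight (insert m A) T x = (if m \<in> N x then weight A T x / (1 - sel T m) else weight A T x)"
proof -
  have loc: "sel (insert m T) y = sel T y" if "y \<in> A" for y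
    using assms that by (intro sel_local[of A]) (auto simp: dclosed_def)
  show "weight (insert m A) (insert m T) x = (if m \<in> N x then 0 else weight A T x)"
  proof (cases "m \<in> N x")
    case False
    have "N x \<inter> insert m A = N x \<inter> A" "N x \<inter> A \<inter> insert m T = N x \<inter> A \<inter> T" using False by auto
    moreover have "(\<Prod>y\<in>N x \<inter> A. 1 / (1 - sel (insert m T) y)) = (\<Prod>y\<in>N x \<inter> A. 1 / (1 - sel T y))"
      by (intro prod.cong) (auto simp: loc)
    ultimately show ?thesis using False by (simp add: weight_def)
  qed (auto simp: weight_def)
  show "weight (insert m A) T x = (if m \<in> N x then weight A T x / (1 - sel T m) else weight A T x)"
  proof (cases "m \<in> N x")
    case True
    then have "N x \<inter> insert m A = insert m (N x \<inter> A)" by auto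
    moreover have "insert m (N x \<inter> A) \<inter> T = N x \<inter> A \<inter> T" using assms by auto
    ultimately show ?thesis using True assms finite_N[of x] by (simp add: weight_def)
  qed (simp add: weight_def)
qed

text \<open>If m is in \<open>N x\<close> and s is its selection probability, the mean of the new
  weight is s * 0 + (1 - s) * w / (1 - s) = w for any s < 1. Thus truncating selection probabilities
  at c does not disturb the mean of the weights.\<close>

lemma expect_weight:
  assumes "finite A" "dclosed A"
  shows "expect A (\<lambda>T. weight A T x) = p"
proof -
  have "dclosed {}" by (simp add: dclosed_def)
  from assms \<open>dclosed {}\<close> empty_subsetI show ?thesis
  proof (induction rule: dclosed_induct)
    case base show ?case by (simp add: expect_empty weight_def)
  next
    case (insert A' m)
    have "expect (insert m A') (\<lambda>T. weight (insert m A') T x) = expect A' (\<lambda>T. weight A' T x)"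
      unfolding expect_insert[OF insert(4,3,5,6)]
    proof (rule expect_cong)
      fix T assume "T \<subseteq> A'"
      then show "sel T m * weight (insert m A') (insert m T) x
          + (1 - sel T m) * weight (insert m A') T x = weight A' T x"
        using insert sel_less_1[of T m] by (cases "m \<in> N x") (simp_all add: weight_insert, simp add: algebra_simps)
    qed
    then show ?case using insert by simp
  qed
qed

text \<open>The two weights are uncorrelated even when x and y are adjacent, although they need not
  be independent. The disjointness hypothesis is where triangle-freeness will enter.\<close>

lemma expect_weight_mult:
  assumes "finite A" "dclosed A" "N x \<inter> N y = {}"
  shows "expect A (\<lambda>T. weight A T x * weight A T y) = p\<^sup>2"
proof -
  have "dclosed {}" by (simp add: dclosed_def)
  from assms(1,2) \<open>dclosed {}\<close> empty_subsetI show ?thesis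
  proof (induction rule: dclosed_induct)
    case base show ?case by (simp add: expect_empty weight_def power2_eq_square)
  next
    case (insert A' m)
    have "expect (insert m A') (\<lambda>T. weight (insert m A') T x * weight (insert m A') T y)
        = expect A' (\<lambda>T. weight A' T x * weight A' T y)"
      unfolding expect_insert[OF insert(4,3,5,6)]
    proof (rule expect_cong)
      fix T assume "T \<subseteq> A'"
      \<comment> \<open>at most one of the two factors changes in each step\<close>
      have "m \<notin> N x \<or> m \<notin> N y" using assms(3) by auto
      then consider "m \<in> N x" "m \<notin> N y" | "m \<notin> N x" "m \<in> N y" | "m \<notin> N x" "m \<notin> N y" by auto
      then show "sel T m * (weight (insert m A') (insert m T) x * weight (insert m A') (insert m T) y)
          + (1 - sel T m) * (weight (insert m A') T x * weight (insert m A') T y)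
          = weight A' T x * weight A' T y"
        using insert \<open>T \<subseteq> A'\<close> sel_less_1[of T m]
        by cases (simp_all add: weight_insert, simp add: algebra_simps)
    qed
    then show ?case using insert by simp
  qed
qed

lemma minus_ln_le:
  fixes t :: real assumes "0 \<le> t" "t \<le> c"
  shows "ln (1 / (1 - t)) \<le> t / (1 - c)"
proof -
  have "ln (1 / (1 - t)) \<le> 1 / (1 - t) - 1"
    using assms c_less_1 by (intro ln_le_minus_one) auto
  also have "\<dots> = t / (1 - t)" using assms c_less_1 by (simp add: field_simps)
  also have "\<dots> \<le> t / (1 - c)" using assms c_less_1 by (intro divide_left_mono mult_pos_pos) auto
  finally show ?thesis .
qed

text \<open>The untruncated weight has mean p, so it remains to bound the mean lost when the weight
  exceeds c. That loss is at most d * p^2 / M by the product formula for adjacent weights.\<close>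

lemma expect_sel_ge:
  assumes A: "finite A" "dclosed A" "x \<in> A" and d: "card (N x) \<le> d"
    and tf: "\<And>y. y \<in> N x \<Longrightarrow> N x \<inter> N y = {}" and pc: "p < c"
  shows "expect A (\<lambda>T. sel T x) \<ge> p * (1 - d * p / ((1 - c) * ln (c / p)))"
proof -
  define M where "M = (1 - c) * ln (c / p)"
  have M: "M > 0" unfolding M_def using pc p_pos c_less_1 by (simp add: ln_gt_zero)
  have NA: "N x \<subseteq> A" and NA': "\<And>y. y \<in> N x \<Longrightarrow> N y \<subseteq> A"
    using A unfolding dclosed_def by auto
  \<comment> \<open>Markov's inequality in pointwise form: when the weight w of x exceeds c, the
    weights of its earlier neighbours have a sum S >= M, so w <= w * S / M.\<close>
  have pt: "weight A T x - (\<Sum>y\<in>N x. 1 / M * (weight A T x * weight A T y)) \<le> sel T x" for T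
  proof (cases "weight A T x \<le> c")
    case True
    then have "sel T x = weight A T x" using sel_eq_weight[OF NA] by simp
    moreover have "(\<Sum>y\<in>N x. 1 / M * (weight A T x * weight A T y)) \<ge> 0"
      using M weight_nonneg by (intro sum_nonneg) simp
    ultimately show ?thesis by simp
  next
    case False
    then have w: "weight A T x > c" "weight A T x > 0" using c_nonneg by auto
    have "N x \<inter> A = N x" using NA by auto
    then have eq: "weight A T x = p * (\<Prod>y\<in>N x. 1 / (1 - sel T y))"
      using w(2) unfolding weight_def by (auto split: if_splits)
    have "ln (c / p) \<le> ln (\<Prod>y\<in>N x. 1 / (1 - sel T y))"
      using w p_pos pc unfolding eq
      by (subst ln_le_cancel_iff) (auto simp: field_simps zero_less_mult_iff)
    also have "\<dots> = (\<Sum>y\<in>N x. ln (1 / (1 - sel T y)))"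
      using finite_N sel_less_1 by (intro ln_prod) (auto simp: less_imp_neq)
    \<comment> \<open>Passing from \<open>sel\<close> to the untruncated weights is a loss, but only
      for the latter is the mean of the product with the weight of x known exactly.\<close>
    also have "\<dots> \<le> (\<Sum>y\<in>N x. weight A T y / (1 - c))"
    proof (intro sum_mono)
      fix y assume "y \<in> N x"
      have "ln (1 / (1 - sel T y)) \<le> sel T y / (1 - c)" by (intro minus_ln_le sel_nonneg sel_le_c)
      also have "\<dots> \<le> weight A T y / (1 - c)"
        using sel_le_weight[OF NA'[OF \<open>y \<in> N x\<close>]] c_less_1 by (intro divide_right_mono) auto
      finally show "ln (1 / (1 - sel T y)) \<le> weight A T y / (1 - c)" .
    qed
    finally have "ln (c / p) \<le> (\<Sum>y\<in>N x. weight A T y) / (1 - c)" by (simp add: sum_divide_distrib)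
    then have "M \<le> (\<Sum>y\<in>N x. weight A T y)"
      unfolding M_def using c_less_1 by (simp add: field_simps)
    then have "weight A T x * M \<le> weight A T x * (\<Sum>y\<in>N x. weight A T y)"
      using w by (intro mult_left_mono) auto
    then have "weight A T x \<le> weight A T x * (\<Sum>y\<in>N x. weight A T y) / M"
      using M by (simp add: pos_le_divide_eq)
    also have "\<dots> = (\<Sum>y\<in>N x. 1 / M * (weight A T x * weight A T y))"
      by (simp add: sum_distrib_left sum_divide_distrib)
    finally show ?thesis using sel_nonneg[of T x] by linarith
  qed
  have "p - card (N x) * (1 / M * p\<^sup>2)
      = expect A (\<lambda>T. weight A T x - (\<Sum>y\<in>N x. 1 / M * (weight A T x * weight A T y)))"
    unfolding expect_diff expect_sum expect_cmult by (simp add: expect_weight expect_weight_mult A tf)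
  also have "\<dots> \<le> expect A (\<lambda>T. sel T x)" by (intro expect_mono pt)
  finally have "p - card (N x) * (1 / M * p\<^sup>2) \<le> expect A (\<lambda>T. sel T x)" .
  moreover have "card (N x) * (1 / M * p\<^sup>2) \<le> d * (1 / M * p\<^sup>2)"
    using d M by (intro mult_right_mono) auto
  moreover have "p * (1 - d * p / M) = p - d * (1 / M * p\<^sup>2)"
    by (simp add: power2_eq_square algebra_simps)
  ultimately show ?thesis unfolding M_def[symmetric] by linarith
qed

text \<open>Restricted to the vertices of smaller rank together with x, the process treats x last,
  so \<open>expect_insert\<close> averages out exactly the choice at x. Marginalisation leads to
  this smaller set and back.\<close>

lemma expect_member:
  assumes A: "finite A" "dclosed A" "x \<in> A"
  shows "expect A (\<lambda>T. of_bool (x \<in> T)) = expect A (\<lambda>T. sel T x)"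
proof -
  define B where "B = {y \<in> A. rank y < rank x}"
  have B: "finite B" "dclosed B" "N x \<subseteq> B" "x \<notin> B" "B \<subseteq> A"
  proof -
    show "dclosed B" unfolding dclosed_def
    proof (intro ballI subsetI)
      fix y z assume "y \<in> B" "z \<in> N y"
      then show "z \<in> B" using A(2) rank_less[of z y] unfolding B_def dclosed_def by force
    qed
    show "N x \<subseteq> B"
    proof
      fix y assume "y \<in> N x"
      then show "y \<in> B" using A(2,3) rank_less[of y x] unfolding B_def dclosed_def by blast
    qed
    show "finite B" "x \<notin> B" "B \<subseteq> A" using A(1) by (auto simp: B_def)
  qed
  have xB: "dclosed (insert x B)" using B unfolding dclosed_def by auto
  have "expect A (\<lambda>T. of_bool (x \<in> T)) = expect (insert x B) (\<lambda>T. of_bool (x \<in> T))"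
    using A B xB by (intro expect_marginal) (auto simp: determined_def)
  also have "\<dots> = expect B (\<lambda>T. sel T x)"
    unfolding expect_insert[OF B(1-4)] using B by (intro expect_cong) auto
  also have "\<dots> = expect A (\<lambda>T. sel T x)"
  proof (rule expect_marginal[symmetric])
    show "determined (\<lambda>T. sel T x) B"
      unfolding determined_def using sel_local[OF B(2,3)] by blast
  qed (use A B in auto)
  finally show ?thesis .
qed

section \<open>The range of dependence and the variance\<close>

definition near :: "('b \<times> 'b) set" where
  "near = {(x, y). x = y \<or> y \<in> N x \<or> x \<in> N y}"

text \<open>The event that x is chosen depends only on which vertices of anc x are chosen.\<close>

definition anc :: "'b \<Rightarrow> 'b set" where
  "anc x = {(x, y). y \<in> N x}\<^sup>* `` {x}"

lemma dclosed_anc: "dclosed (anc x)"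
  unfolding dclosed_def anc_def by (auto intro: rtrancl_into_rtrancl)

lemma anc_subset:
  assumes "dclosed A" "x \<in> A" shows "anc x \<subseteq> A"
proof
  fix y assume "y \<in> anc x"
  then have "(x, y) \<in> {(x, y). y \<in> N x}\<^sup>*" by (simp add: anc_def)
  then show "y \<in> A" using assms by induction (auto simp: dclosed_def)
qed

text \<open>This is what the diagonal in \<open>near\<close> provides: its powers are balls rather
  than sets of endpoints of walks of an exact length.\<close>

lemma near_relpow_mono:
  assumes "(x, y) \<in> near ^^ k" "k \<le> l" shows "(x, y) \<in> near ^^ l"
  using assms(2,1)
proof (induction rule: dec_induct)
  case (step n)
  then show ?case by (auto simp: near_def intro!: relcompI[where b = y])
qed simp

lemma anc_near:
  assumes "y \<in> anc x" shows "(x, y) \<in> near ^^ rank x"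
proof -
  have "(x, y) \<in> {(x, y). y \<in> N x}\<^sup>*" using assms by (simp add: anc_def)
  \<comment> \<open>Each step to an earlier neighbour lowers the rank, so the number of steps is
    paid for by the drop in rank.\<close>
  then have "\<exists>k. (x, y) \<in> near ^^ k \<and> rank y + k \<le> rank x"
  proof induction
    case base
    show ?case by (rule exI[of _ 0]) simp
  next
    case (step y z)
    then obtain k where k: "(x, y) \<in> near ^^ k" "rank y + k \<le> rank x" by blast
    have "(x, z) \<in> near ^^ Suc k" using k(1) step by (auto simp: near_def)
    moreover have "rank z + Suc k \<le> rank x" using k(2) step rank_less[of z y] by auto
    ultimately show ?case by blast
  qed
  then show ?thesis using near_relpow_mono by force
qed

lemma sym_near: "sym (near ^^ k)"
proof (induction k)
  case (Suc k)
  have "sym near" by (auto simp: near_def sym_def)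
  then show ?case using Suc by (auto simp: sym_def relpow_commute intro: relcompI)
      (metis relcomp.relcompI relpow_commute)
qed (auto simp: sym_def)

lemma card_near_relpow:
  assumes "\<And>x. finite (near `` {x})" "\<And>x. card (near `` {x}) \<le> D"
  shows "finite ((near ^^ k) `` {x}) \<and> card ((near ^^ k) `` {x}) \<le> D ^ k"
proof (induction k)
  case (Suc k)
  have eq: "(near ^^ Suc k) `` {x} = (\<Union>y\<in>(near ^^ k) `` {x}. near `` {y})" by auto
  have "card ((near ^^ Suc k) `` {x}) \<le> (\<Sum>y\<in>(near ^^ k) `` {x}. card (near `` {y}))"
    unfolding eq by (rule card_UN_le) (use Suc in simp)
  also have "\<dots> \<le> (\<Sum>y\<in>(near ^^ k) `` {x}. D)" by (intro sum_mono assms)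
  also have "\<dots> \<le> D ^ Suc k" using Suc by simp
  finally show ?case unfolding eq using Suc assms by auto
qed simp

text \<open>Covariances vanish when the ancestor sets are disjoint. Otherwise a common ancestor puts
  y in the ball of radius 2r around x, which has at most D^(2r) elements, and the covariance is at
  most 1.\<close>

lemma variance_le:
  assumes A: "finite A" "dclosed A" "Q \<subseteq> A"
    and r: "\<And>x. x \<in> A \<Longrightarrow> rank x \<le> r"
    and D: "\<And>x. finite (near `` {x})" "\<And>x. card (near `` {x}) \<le> D"
  defines "X \<equiv> (\<lambda>T. real (card (T \<inter> Q)))"
  shows "expect A (\<lambda>T. (X T - expect A X)\<^sup>2) \<le> card Q * D ^ (r + r)"
proof -
  have finQ: "finite Q" using A finite_subset by blast
  define I :: "'b \<Rightarrow> 'b set \<Rightarrow> real" where "I = (\<lambda>x T. of_bool (x \<in> T))"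
  have X: "X T = (\<Sum>x\<in>Q. I x T)" for T
    unfolding X_def I_def using finQ by (simp add: of_bool_def sum.If_cases Int_commute)
  have cov: "expect A (\<lambda>T. I x T * I y T) - expect A (I x) * expect A (I y)
      \<le> of_bool (y \<in> (near ^^ (r + r)) `` {x})"
    if "x \<in> Q" "y \<in> Q" for x y
  proof (cases "anc x \<inter> anc y = {}")
    case True
    have sub: "anc x \<subseteq> A" "anc y \<subseteq> A" using that A(2,3) by (meson anc_subset subsetD)+
    then have fin: "finite (anc x)" "finite (anc y)" using A finite_subset by blast+
    have det: "determined (I z) (anc z)" for z
      unfolding determined_def I_def anc_def by auto
    have "expect A (\<lambda>T. I x T * I y T) = expect (anc x \<union> anc y) (\<lambda>T. I x T * I y T)"
    proof (rule expect_marginal)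
      show "dclosed (anc x \<union> anc y)" using dclosed_anc[of x] dclosed_anc[of y]
        unfolding dclosed_def by blast
      show "determined (\<lambda>T. I x T * I y T) (anc x \<union> anc y)"
        unfolding determined_def I_def anc_def by auto
    qed (use A sub in auto)
    also have "\<dots> = expect (anc x) (I x) * expect (anc y) (I y)"
      by (intro expect_indep dclosed_anc True det fin)
    also have "\<dots> = expect A (I x) * expect A (I y)"
      using expect_marginal[OF A(1,2) dclosed_anc _ det] sub by simp
    finally show ?thesis by simp
  next
    case False
    then obtain z where z: "z \<in> anc x" "z \<in> anc y" by auto
    have xy: "rank x \<le> r" "rank y \<le> r" using that A r by auto
    have "(x, z) \<in> near ^^ r" using anc_near[OF z(1)] near_relpow_mono xy by blast
    moreover have "(z, y) \<in> near ^^ r"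
      using anc_near[OF z(2)] near_relpow_mono xy sym_near symD by metis
    ultimately have "(x, y) \<in> near ^^ (r + r)" unfolding relpow_add by auto
    moreover have "expect A (\<lambda>T. I x T * I y T) \<le> 1"
      using expect_mono[of A "\<lambda>T. I x T * I y T" "\<lambda>_. 1"] expect_const[OF A(1,2)] by (simp add: I_def)
    moreover have "0 \<le> expect A (I x)" "0 \<le> expect A (I y)"
      using expect_mono[of A "\<lambda>_. 0" "I x"] expect_mono[of A "\<lambda>_. 0" "I y"] expect_const[OF A(1,2)]
      by (simp_all add: I_def)
    ultimately have "expect A (\<lambda>T. I x T * I y T) - expect A (I x) * expect A (I y) \<le> 1"
      and "(x, y) \<in> near ^^ (r + r)" by (smt (verit) mult_nonneg_nonneg)+
    then show ?thesis by simp
  qed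
  have "expect A (\<lambda>T. (X T - expect A X)\<^sup>2) = expect A (\<lambda>T. X T * X T) - expect A X * expect A X"
  proof -
    have "(\<lambda>T. (X T - expect A X)\<^sup>2) = (\<lambda>T. X T * X T - (2 * expect A X) * X T + expect A X * expect A X)"
      by (simp add: power2_eq_square algebra_simps fun_eq_iff)
    then show ?thesis unfolding expect_add expect_diff expect_cmult
      using A by (simp add: expect_add expect_diff expect_cmult expect_const)
  qed
  also have "expect A (\<lambda>T. X T * X T) = (\<Sum>x\<in>Q. \<Sum>y\<in>Q. expect A (\<lambda>T. I x T * I y T))"
    unfolding X sum_product expect_sum ..
  also have "expect A X * expect A X = (\<Sum>x\<in>Q. \<Sum>y\<in>Q. expect A (I x) * expect A (I y))"
    unfolding X[abs_def] expect_sum sum_product ..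
  also have "(\<Sum>x\<in>Q. \<Sum>y\<in>Q. expect A (\<lambda>T. I x T * I y T)) - (\<Sum>x\<in>Q. \<Sum>y\<in>Q. expect A (I x) * expect A (I y))
      = (\<Sum>x\<in>Q. \<Sum>y\<in>Q. expect A (\<lambda>T. I x T * I y T) - expect A (I x) * expect A (I y))"
    by (simp add: sum_subtractf)
  also have "\<dots> \<le> (\<Sum>x\<in>Q. real (D ^ (r + r)))"
  proof (intro sum_mono)
    fix x assume "x \<in> Q"
    have "(\<Sum>y\<in>Q. expect A (\<lambda>T. I x T * I y T) - expect A (I x) * expect A (I y))
        \<le> (\<Sum>y\<in>Q. of_bool (y \<in> (near ^^ (r + r)) `` {x}))"
      using \<open>x \<in> Q\<close> by (intro sum_mono cov)
    also have "\<dots> = real (card (Q \<inter> (near ^^ (r + r)) `` {x}))"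
      using finQ by (simp add: of_bool_def sum.If_cases Image_singleton)
    also have "\<dots> \<le> real (D ^ (r + r))"
      unfolding of_nat_le_iff
      using card_near_relpow[OF D, of "r + r" x] card_mono[of "(near ^^ (r + r)) `` {x}"]
      by (meson Int_lower2 le_trans)
    finally show "(\<Sum>y\<in>Q. expect A (\<lambda>T. I x T * I y T) - expect A (I x) * expect A (I y)) \<le> real (D ^ (r + r))" .
  qed
  finally show ?thesis by simp
qed

lemma expect_card_Int:
  assumes "finite A" "dclosed A" "Q \<subseteq> A"
  shows "expect A (\<lambda>T. real (card (T \<inter> Q))) = (\<Sum>x\<in>Q. expect A (\<lambda>T. sel T x))"
proof -
  have finQ: "finite Q" using assms finite_subset by blast
  have "expect A (\<lambda>T. real (card (T \<inter> Q))) = expect A (\<lambda>T. \<Sum>x\<in>Q. of_bool (x \<in> T))"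
    using finQ by (simp add: of_bool_def sum.If_cases Int_commute)
  also have "\<dots> = (\<Sum>x\<in>Q. expect A (\<lambda>T. sel T x))"
    unfolding expect_sum using assms by (intro sum.cong) (auto simp: expect_member)
  finally show ?thesis .
qed

text \<open>A chosen earlier neighbour forces \<open>sel T x\<close> = 0, so outcomes of positive
  probability will be independent sets.\<close>

lemma prob_nonzero_N:
  assumes "finite A" "T \<subseteq> A" "prob A T \<noteq> 0" "x \<in> T"
  shows "N x \<inter> T = {}"
proof (rule ccontr)
  assume "N x \<inter> T \<noteq> {}"
  then have "sel T x = 0" using sel.simps[of T x] by (simp add: Let_def)
  then have "prob A T = 0" unfolding prob_def using assms by (intro prod_zero) auto
  then show False using assms by simp
qed

end


section \<open>Running the process on a DP-cover\<close>

lemma DP_coloring_exists: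
  fixes L :: "'a \<Rightarrow> 'b set" and p c \<delta> :: real
  assumes tf: "triangle_free E" and deg: "degenerate d V E"
    and cover: "DP_cover V E L VH EH" and q: "q_fold q V L"
    and p: "0 < p" "p < c" "c < 1"
    and gap: "\<delta> > 0" "real q * \<delta>\<^sup>2 > real (card V * (card V + 1) ^ (card V + card V))"
  shows "\<exists>S. DP_coloring (p * (1 - d * p / ((1 - c) * ln (c / p))) - \<delta>) V L VH EH S"
proof -
  define \<eta> where "\<eta> = p * (1 - d * p / ((1 - c) * ln (c / p)))"
  obtain xs where xs: "distinct xs" "set xs = V"
    "\<And>i. i < length xs \<Longrightarrow> card {j. j < i \<and> {xs ! j, xs ! i} \<in> E} \<le> d"
    using deg unfolding degenerate_def by blast
  have len: "length xs = card V" using xs distinct_card by fastforce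
  have finV: "finite V" using xs by auto
  define idx where "idx = inv_into {..<length xs} ((!) xs)"
  have img: "(!) xs ` {..<length xs} = V"
    using xs(2) by (auto simp: set_conv_nth)
  have idx: "idx v < card V" "xs ! idx v = v" if "v \<in> V" for v
    using inv_into_into[of v "(!) xs" "{..<length xs}"] f_inv_into_f[of v "(!) xs" "{..<length xs}"]
      that img len unfolding idx_def by auto
  have finVH: "finite VH" and
    edge_VH: "\<And>x y. {x, y} \<in> EH \<Longrightarrow> x \<in> VH \<and> y \<in> VH \<and> x \<noteq> y"
    using cover unfolding DP_cover_def fin_simple_graph_def by (fastforce simp: doubleton_eq_iff)+
  have LVH: "L v \<subseteq> VH" if "v \<in> V" for v
    using cover that unfolding DP_cover_def independent_set_def by auto
  have "\<exists>v\<in>V. x \<in> L v" if "x \<in> VH" for x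
    using cover that unfolding DP_cover_def partition_on_def by blast
  then obtain own where own: "\<And>x. x \<in> VH \<Longrightarrow> own x \<in> V" "\<And>x. x \<in> VH \<Longrightarrow> x \<in> L (own x)"
    by metis
  have own_edge: "own x \<noteq> own y \<and> {own x, own y} \<in> E" if xy: "{x, y} \<in> EH" for x y
  proof -
    have o: "own x \<in> V" "own y \<in> V" "x \<in> L (own x)" "y \<in> L (own y)"
      using edge_VH[OF xy] own by auto
    have "own x \<noteq> own y"
    proof
      assume "own x = own y"
      then have "{x, y} \<in> induced_edges EH (L (own x))" using o xy unfolding induced_edges_def by auto
      then show False using cover o unfolding DP_cover_def independent_set_def by blast
    qed
    moreover have "{x, y} \<in> induced_edges EH (L (own x) \<union> L (own y))"
      using o xy unfolding induced_edges_def by auto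
    ultimately show ?thesis using cover o unfolding DP_cover_def by blast
  qed
  \<comment> \<open>Two edges from x into the same list share x, so the matching condition makes
    them equal.\<close>
  have own_inj: "y = z" if xy: "{x, y} \<in> EH" and xz: "{x, z} \<in> EH" and eq: "own y = own z" for x y z
  proof -
    define M where "M = induced_edges EH (L (own x) \<union> L (own y))"
    have "x \<in> L (own x)" "y \<in> L (own y)" "z \<in> L (own y)"
      using edge_VH[OF xy] edge_VH[OF xz] own(2) eq by metis+
    then have "{x, y} \<in> M" "{x, z} \<in> M"
      using xy xz unfolding M_def induced_edges_def by auto
    moreover have "disjoint M"
      using cover own_edge[OF xy] edge_VH[OF xy] own unfolding M_def DP_cover_def matching_def by blast
    ultimately have "{x, y} = {x, z}" by (auto dest: disjointD)
    then show ?thesis by (auto simp: doubleton_eq_iff)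
  qed
  \<comment> \<open>The whole list of v gets the position of v in the degeneracy order. Ties are
    harmless, since no edge joins two elements of one list.\<close>
  define rank where "rank x = idx (own x)" for x
  define N where "N x = {y. {x, y} \<in> EH \<and> rank y < rank x}" for x
  interpret sequential_choice N rank p c
  proof
    show "finite (N x)" for x
      using edge_VH by (intro finite_subset[OF _ finVH]) (auto simp: N_def)
  qed (use p in \<open>auto simp: N_def\<close>)
  have dVH: "dclosed VH" unfolding dclosed_def N_def using edge_VH by auto
  \<comment> \<open>By \<open>own_inj\<close>, the earlier neighbours of x inject into the earlier
    neighbours of \<open>own x\<close> in G, of which there are at most d.\<close>
  have card_N: "card (N x) \<le> d" if "x \<in> VH" for x
  proof -
    have "rank ` N x \<subseteq> {j. j < rank x \<and> {xs ! j, xs ! rank x} \<in> E}"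
    proof (rule image_subsetI)
      fix y assume "y \<in> N x"
      then have y: "{x, y} \<in> EH" "rank y < rank x" by (auto simp: N_def)
      have "xs ! rank y = own y" "xs ! rank x = own x"
        using edge_VH[OF y(1)] own(1) idx(2) by (auto simp: rank_def)
      then show "rank y \<in> {j. j < rank x \<and> {xs ! j, xs ! rank x} \<in> E}"
        using y(2) own_edge[OF y(1)] by (simp add: insert_commute)
    qed
    then have "card (rank ` N x) \<le> card {j. j < rank x \<and> {xs ! j, xs ! rank x} \<in> E}"
      by (intro card_mono) auto
    also have "\<dots> \<le> d"
      using xs(3) idx(1) own(1) that len unfolding rank_def by auto
    finally have "card (rank ` N x) \<le> d" .
    moreover have "inj_on rank (N x)"
    proof (rule inj_onI)
      fix y z assume yz: "y \<in> N x" "z \<in> N x" "rank y = rank z"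
      then have "{x, y} \<in> EH" "{x, z} \<in> EH" by (auto simp: N_def)
      moreover have "own y = own z"
        using yz(3) edge_VH[OF calculation(1)] edge_VH[OF calculation(2)] own(1) idx(2)
        unfolding rank_def by metis
      ultimately show "y = z" by (rule own_inj)
    qed
    ultimately show ?thesis by (simp add: card_image)
  qed
  \<comment> \<open>A triangle in the cover projects along \<open>own\<close> to a triangle in
    G.\<close>
  have tfN: "N x \<inter> N y = {}" if y: "y \<in> N x" for x y
  proof (rule ccontr)
    assume "N x \<inter> N y \<noteq> {}"
    then obtain z where "{x, y} \<in> EH" "{x, z} \<in> EH" "{y, z} \<in> EH" using y by (auto simp: N_def)
    then have "{own x, own y} \<in> E" "{own y, own z} \<in> E" "{own x, own z} \<in> E" using own_edge by auto
    then show False using tf unfolding triangle_free_def by blast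
  qed
  \<comment> \<open>A bound independent of q, which makes the variance linear in q. The extra 1
    accounts for x itself.\<close>
  have near: "finite (near `` {x}) \<and> card (near `` {x}) \<le> card V + 1" for x
  proof -
    define B where "B = {y. {x, y} \<in> EH}"
    have sub: "near `` {x} \<subseteq> insert x B"
      unfolding near_def N_def B_def by (auto simp: insert_commute)
    have fin: "finite B"
      using edge_VH unfolding B_def by (intro finite_subset[OF _ finVH]) auto
    have "card B \<le> card V"
    proof (rule card_inj_on_le[of own])
      show "inj_on own B"
      proof (rule inj_onI)
        fix y z assume "y \<in> B" "z \<in> B" "own y = own z"
        then show "y = z" using own_inj[of x y z] by (simp add: B_def)
      qed
      show "own ` B \<subseteq> V" using edge_VH own by (auto simp: B_def)
    qed (rule finV)
    then have "card (insert x B) \<le> card V + 1" using fin by (simp add: card_insert_if)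
    then show ?thesis
      using sub fin card_mono[of "insert x B" "near `` {x}"] finite_subset[OF sub] by simp
  qed
  have rank_le: "rank x \<le> card V" if "x \<in> VH" for x
    using idx own that unfolding rank_def by (simp add: less_imp_le)
  define X where "X u T = real (card (T \<inter> L u))" for u T
  define \<mu> where "\<mu> u = expect VH (X u)" for u
  have mean: "\<mu> u \<ge> q * \<eta>" if "u \<in> V" for u
  proof -
    have "q * \<eta> = (\<Sum>x\<in>L u. \<eta>)" using q that unfolding q_fold_def by simp
    also have "\<dots> \<le> (\<Sum>x\<in>L u. expect VH (\<lambda>T. sel T x))"
      unfolding \<eta>_def using that LVH p(2) finVH dVH card_N tfN
      by (intro sum_mono expect_sel_ge) auto
    also have "\<dots> = \<mu> u"
      unfolding \<mu>_def X_def using that by (intro expect_card_Int[symmetric] finVH dVH LVH)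
    finally show ?thesis .
  qed
  have var: "expect VH (\<lambda>T. (X u T - \<mu> u)\<^sup>2) \<le> q * (card V + 1) ^ (card V + card V)" if "u \<in> V" for u
  proof -
    have "card (L u) = q" using q that by (simp add: q_fold_def)
    then show ?thesis
      using variance_le[OF finVH dVH LVH[OF that] rank_le, of "card V + 1"] near
      unfolding X_def \<mu>_def by simp
  qed
  \<comment> \<open>Second moment over all lists at once: if every outcome of positive probability
    failed at some u, the sum of the squared deviations would always be at least (q \<delta>)^2,
    while its mean is of order q. The assumption \<open>gap\<close> says that q is large enough to
    exclude this.\<close>
  have "\<exists>T. T \<subseteq> VH \<and> prob VH T \<noteq> 0 \<and> (\<forall>u\<in>V. X u T \<ge> q * (\<eta> - \<delta>))"
  proof (rule ccontr)
    assume bad: "\<not> ?thesis"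
    have "(q * \<delta>)\<^sup>2 = expect VH (\<lambda>_. (q * \<delta>)\<^sup>2)" by (simp add: expect_const finVH dVH)
    also have "\<dots> \<le> expect VH (\<lambda>T. \<Sum>u\<in>V. (X u T - \<mu> u)\<^sup>2)"
    proof (rule expect_mono)
      fix T assume "T \<subseteq> VH" "prob VH T \<noteq> 0"
      then have "\<not> (\<forall>u\<in>V. q * (\<eta> - \<delta>) \<le> X u T)" using bad by blast
      then obtain u where u: "u \<in> V" "X u T < q * (\<eta> - \<delta>)" by (meson not_le)
      have "q * \<delta> \<le> \<mu> u - X u T" using mean[OF u(1)] u(2) by (simp add: algebra_simps)
      then have "(q * \<delta>)\<^sup>2 \<le> (\<mu> u - X u T)\<^sup>2" using gap(1) by (intro power_mono) auto
      also have "\<dots> = (X u T - \<mu> u)\<^sup>2" by (rule power2_commute)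
      also have "\<dots> \<le> (\<Sum>u\<in>V. (X u T - \<mu> u)\<^sup>2)" using u(1) finV by (intro member_le_sum) auto
      finally show "(q * \<delta>)\<^sup>2 \<le> (\<Sum>u\<in>V. (X u T - \<mu> u)\<^sup>2)" .
    qed
    also have "\<dots> = (\<Sum>u\<in>V. expect VH (\<lambda>T. (X u T - \<mu> u)\<^sup>2))" by (rule expect_sum)
    also have "\<dots> \<le> (\<Sum>u\<in>V. real (q * (card V + 1) ^ (card V + card V)))"
      by (intro sum_mono) (use var in simp)
    finally have "q * (q * \<delta>\<^sup>2) \<le> q * real (card V * (card V + 1) ^ (card V + card V))"
      by (simp add: power2_eq_square algebra_simps)
    moreover have "q > 0"
    proof (rule ccontr)
      assume "\<not> q > 0"
      then have "real (card V * (card V + 1) ^ (card V + card V)) < 0" using gap(2) by simp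
      then show False by (simp only: of_nat_less_0_iff)
    qed
    ultimately have "q * \<delta>\<^sup>2 \<le> real (card V * (card V + 1) ^ (card V + card V))"
      by (simp only: mult_le_cancel_left_pos of_nat_0_less_iff)
    then show False using gap(2) by linarith
  qed
  then obtain T where T: "T \<subseteq> VH" "prob VH T \<noteq> 0" "\<And>u. u \<in> V \<Longrightarrow> X u T \<ge> q * (\<eta> - \<delta>)" by blast
  have "e \<notin> EH" if "e \<subseteq> T" for e
  proof
    assume e: "e \<in> EH"
    have "\<forall>e\<in>EH. \<exists>x\<in>VH. \<exists>y\<in>VH. x \<noteq> y \<and> e = {x, y}"
      using cover unfolding DP_cover_def fin_simple_graph_def by (elim conjE)
    then obtain x y where xy: "e = {x, y}" using e by blast
    have xyV: "own x \<in> V" "own y \<in> V" "own x \<noteq> own y"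
      using edge_VH[of x y] own(1) own_edge[of x y] e unfolding xy by auto
    then have "rank x \<noteq> rank y" unfolding rank_def using idx(2) by metis
    then have "y \<in> N x \<or> x \<in> N y" using e unfolding xy N_def by (auto simp: insert_commute)
    then show False
      using prob_nonzero_N[OF finVH T(1,2), of x] prob_nonzero_N[OF finVH T(1,2), of y] that
      unfolding xy by auto
  qed
  then have "independent_set VH EH T"
    using T(1) unfolding independent_set_def induced_edges_def by auto
  moreover have "real (card (T \<inter> L u)) \<ge> (\<eta> - \<delta>) * real (card (L u))" if "u \<in> V" for u
    using T(3)[OF that] q that unfolding X_def q_fold_def by (simp add: mult.commute)
  ultimately show ?thesis unfolding DP_coloring_def \<eta>_def[symmetric] by blast
qed

section \<open>From colourings of large covers to the fractional DP-chromatic number\<close>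

lemma chi_f_DP_le:
  fixes V :: "'a set" and p c \<eta> :: real
  assumes "triangle_free E" "degenerate d V E" "0 < p" "p < c" "c < 1"
    and \<eta>: "\<eta> = p * (1 - d * p / ((1 - c) * ln (c / p)))" "\<eta> > 0"
  shows "chi_f_DP V E \<le> ereal (1 / \<eta>)"
proof -
  have M: "(1 - c) * ln (c / p) > 0" using assms by (simp add: ln_gt_zero)
  have "\<eta> \<le> p * 1"
    unfolding \<eta>(1) using assms M by (intro mult_left_mono) auto
  then have "\<eta> \<le> 1" using assms(4,5) by linarith
  \<comment> \<open>The deviation \<eta> - t is fixed first, then q is taken large in terms of it
    and of \<open>card V\<close>; this dependence on G is harmless under the infimum over q.\<close>
  have *: "chi_f_DP V E \<le> ereal (1 / t)" if t: "0 < t" "t < \<eta>" for t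
  proof -
    define K where "K = real (card V * (card V + 1) ^ (card V + card V))"
    obtain q :: nat where q: "q > K / (\<eta> - t)\<^sup>2" using reals_Archimedean2 by blast
    have "K \<ge> 0" unfolding K_def by simp
    then have "0 \<le> K / (\<eta> - t)\<^sup>2" by simp
    then have "q \<ge> 1" using q by (cases q) auto
    have "q * (\<eta> - t)\<^sup>2 > K" using q t by (simp add: pos_divide_less_eq)
    then have "\<exists>S. DP_coloring t V L VH EH S"
      if "DP_cover V E L VH EH" "q_fold q V L" for L :: "'a \<Rightarrow> nat set" and VH EH
      using DP_coloring_exists[OF assms(1,2) that assms(3-5), of "\<eta> - t"] t
      unfolding K_def \<eta>(1) by simp
    then have "t \<in> admissible_fractions V E q"
      using t \<open>\<eta> \<le> 1\<close> unfolding admissible_fractions_def by auto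
    then have "t \<le> theta_DP V E q"
      unfolding theta_DP_def by (rule cSup_upper[OF _ bdd_above_admissible])
    then have "inverse (ereal (theta_DP V E q)) \<le> inverse (ereal t)"
      using t by (intro ereal_inverse_antimono) auto
    also have "\<dots> = ereal (1 / t)" using t by (simp add: divide_inverse)
    finally show ?thesis
      unfolding chi_f_DP_def using \<open>q \<ge> 1\<close> by (meson INF_lower2 atLeast_iff)
  qed
  \<comment> \<open>To let t tend to \<eta>, a number r strictly between 1 / \<eta> and
    \<open>chi_f_DP V E\<close> is refuted with t = 1 / r.\<close>
  show ?thesis
  proof (rule ccontr)
    assume "\<not> ?thesis"
    then obtain r where r: "1 / \<eta> < r" "ereal r < chi_f_DP V E"
      using ereal_dense2[of "ereal (1 / \<eta>)"] by (auto simp: not_le)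
    have "r > 0" using r(1) \<eta>(2) by (meson less_trans zero_less_divide_1_iff)
    then have "chi_f_DP V E \<le> ereal (1 / (1 / r))"
      using r(1) \<eta>(2) by (intro *) (auto simp: field_simps)
    then show False using r(2) by simp
  qed
qed

section \<open>Choice of the parameters and asymptotics\<close>

theorem mainTheorem4:
  shows "\<exists>\<epsilon> :: nat \<Rightarrow> real. \<epsilon> \<longlonglongrightarrow> 0 \<and>
    (\<forall>d\<ge>2. \<forall>(V :: 'a set) E.
       fin_simple_graph V E \<and> triangle_free E \<and> degenerate d V E \<longrightarrow>
       chi_f_DP V E \<le> ereal ((4 + \<epsilon> d) * (real d / ln (real d))))"
proof -
  define F where "F d p c = p * (1 - d * p / ((1 - c) * ln (c / p)))" for d p c :: real
  \<comment> \<open>With p = a ln d / d and c = 1 / ln d one has c -> 0 and ln (c / p) ~ ln d, so F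
    ~ a (1 - a) ln d / d. The maximum at a = 1/2 yields the constant 4.\<close>
  define P where "P d = ln d / (2 * d)" for d :: real
  define C where "C d = 1 / ln d" for d :: real
  define good where
    "good d \<longleftrightarrow> 0 < P d \<and> P d < C d \<and> C d < 1 \<and> 0 < F d (P d) (C d)" for d :: real
  define \<eta> where "\<eta> d = (if good d then F d (P d) (C d) else F d (1 / (6 * d)) (1 / 2))" for d :: real
  \<comment> \<open>Chosen so that the claimed bound is exactly 1 / \<eta>; only the limit of
    \<epsilon> depends on the asymptotics.\<close>
  define \<epsilon> where "\<epsilon> d = 1 / \<eta> (real d) * (ln (real d) / real d) - 4" for d :: nat
  have "eventually (\<lambda>d. 0 < P d) at_top" "eventually (\<lambda>d. P d < C d) at_top"
    "eventually (\<lambda>d. C d < 1) at_top" "eventually (\<lambda>d. 0 < F d (P d) (C d)) at_top"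
    unfolding P_def C_def F_def by real_asymp+
  then have good: "eventually good at_top"
    unfolding good_def by (intro eventually_conj)
  have "((\<lambda>d. 1 / F d (P d) (C d) * (ln d / d) - 4) \<longlongrightarrow> 0) at_top"
    unfolding P_def C_def F_def by real_asymp
  then have "((\<lambda>d. 1 / \<eta> d * (ln d / d) - 4) \<longlongrightarrow> 0) at_top"
    by (rule Lim_transform_eventually) (use good in \<open>auto simp: \<eta>_def elim: eventually_mono\<close>)
  then have "\<epsilon> \<longlonglongrightarrow> 0"
    unfolding \<epsilon>_def by (rule filterlim_compose[OF _ filterlim_real_sequentially])
  moreover have "chi_f_DP V E \<le> ereal ((4 + \<epsilon> d) * (real d / ln (real d)))"
    if d: "d \<ge> 2" and G: "triangle_free E" "degenerate d V E" for d and V :: "'a set" and E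
  proof -
    \<comment> \<open>for the finitely many small d, where the optimal p and c are useless, any positive bound will do\<close>
    have "chi_f_DP V E \<le> ereal (1 / \<eta> d)"
    proof (cases "good d")
      case True
      then show ?thesis
        using chi_f_DP_le[OF G, of "P d" "C d"] unfolding good_def \<eta>_def F_def by simp
    next
      case False
      define p where "p = 1 / (6 * real d)"
      have p: "0 < p" "p < 1 / 2" "d * p = 1 / 6" using d unfolding p_def by (auto simp: field_simps)
      \<comment> \<open>Here c / p = 3 d is at least e, so the logarithm is at least 1 and the lost
        fraction is at most (1/6) / (1/2) = 1/3.\<close>
      have "exp 1 \<le> (1 / 2) / p" using exp_le d unfolding p_def by (simp add: field_simps)
      then have "1 \<le> ln ((1 / 2) / p)" using p by (subst ln_ge_iff) auto
      then have "1 / 6 / ((1 - 1 / 2) * ln ((1 / 2) / p)) < 1" by (subst divide_less_eq_1_pos) auto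
      then have "F d p (1 / 2) > 0" unfolding F_def p(3) using p(1) by (intro mult_pos_pos) auto
      then show ?thesis
        using chi_f_DP_le[OF G p(1,2)] False unfolding \<eta>_def p_def F_def by simp
    qed
    \<comment> \<open>For d >= 2 both d and ln d are nonzero, so the two quotients cancel.\<close>
    moreover have "(4 + \<epsilon> d) * (real d / ln (real d)) = 1 / \<eta> d"
      using d unfolding \<epsilon>_def by simp
    ultimately show ?thesis by simp
  qed
  ultimately show ?thesis by blast
qed

end
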